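(* Let $d\ge1$. A T-mesh $\mathscr T$ is diagonalizable if and only if it admits a $t$-partition $\{\overline l_1,\dots,\overline l_t\}$ such that every local conformality matrix $M(\overline l_i)$ has full row rank, where $t$ is the number of T $l$-edges of $T(\mathscr T)$. In that case, $$\operatorname{rank}M(T(\mathscr T))=\sum_{i=1}^{t}\operatorname{rank}M(\overline l_i)=t(d+1).$$
   Context: **T-mesh.** A T-mesh $\mathscr{T}=(\mathcal T_0,\mathcal T_1,\mathcal T_2)$ of $\mathbb R^2$ consists of a finite set $\mathcal T_2$ of closed axis-aligned rectangles (cells), a finite set $\mathcal T_1$ of closed horizontal and vertical segments (edges) contained in $\bigcup_{f\in\mathcal T_2}\partial f$, and the finite set $\mathcal T_0=\bigcup_{l\in\mathcal T_1}\partial l$ of vertices ($\partial l$ = endpoints of $l$), such that: each $\partial f$, $f\in\mathcal T_2$, is a finite union of edges; for distinct cells $f,f'$, $f\cap f'=\partial f\cap\partial f'$ is a finite union of elements of $\mathcal T_0\cup\mathcal T_1$; for distinct edges $l,l'$, $l\cap l'=\partial l\cap\partial l'\subseteq\mathcal T_0$; each vertex is the intersection of a horizontal and a vertical edge. The domain is $\Omega=\bigcup_{f\in\mathcal T_2}f$; it is assumed simply connected with connected interior $\Omega^0$. Vertices in $\Omega^0$ are interior vertices; edges not contained in $\partial\Omega$ are interior edges. **$l$-edges.** A segment of $\mathscr T$ is a connected union of collinear mesh edges; an $l$-edge is a maximal such segment. An $l$-edge made of interior edges is an interior $l$-edge; a T $l$-edge is an interior $l$-edge whose two endpoints are both interior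 vertices. The T-connected component $T(\mathscr T)$ is the edge–vertex configuration formed by all T $l$-edges and all vertices lying on them; it is assumed connected. It is also assumed that no T $l$-edge is vanishable, i.e. every T $l$-edge carries at least $d+2$ vertices. **$t$-partition, diagonalizability.** For an ordering $l_1\succ\cdots\succ l_t$ of all T $l$-edges, put $\overline l_1=l_1$ and, for $i\ge2$, let $\overline l_i$ be $l_i$ with the intersection vertices shared with $l_1,\dots,l_{i-1}$ removed. The set $\{\overline l_1,\dots,\overline l_t\}$ is a $t$-partition of $T(\mathscr T)$; $n(\overline l_i)$ is the number of vertices retained on $\overline l_i$. $\mathscr T$ is diagonalizable (for degree $d$) if some $t$-partition satisfies $n(\overline l_i)\ge d+1$ for all $i$. **Conformality matrices.** Let $S$ be $T(\mathscr T)$ or a single retained edge $\overline l_i$. Assign an unknown $\delta_v$ to each retained vertex $v$ of $S$. For each $l$-edge $l$ of $S$ with retained vertices $v_1,\dots,v_r$ having coordinates $x_1,\dots,x_r$ along $l$ ($x$-coordinates if $l$ is horizontal, $y$-coordinates if vertical), impose the $d+1$ linear equations $\sum_{j=1}^r x_j^k\delta_{v_j}=0$, $k=0,\dots,d$. $M(S)$ is the coefficient matrix of all these equations. In particular $M(\overline l_i)$ has $d+1$ rows and $n(\overline l_i)$ columns. *)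

theory Defs
  imports "HOL-Analysis.Analysis" "Jordan_Normal_Form.DL_Rank"
begin

type_synonym point = "real \<times> real"

definition rectangle :: "point set \<Rightarrow> bool" where
  "rectangle f \<longleftrightarrow> (\<exists>a b. fst a < fst b \<and> snd a < snd b \<and> f = cbox a b)"

definition horizontal :: "point set \<Rightarrow> bool" where
  "horizontal l \<longleftrightarrow> (\<exists>p q. p \<noteq> q \<and> snd p = snd q \<and> l = closed_segment p q)"

definition vertical :: "point set \<Rightarrow> bool" where
  "vertical l \<longleftrightarrow> (\<exists>p q. p \<noteq> q \<and> fst p = fst q \<and> l = closed_segment p q)"

definition endpoints :: "point set \<Rightarrow> point set" where
  "endpoints l = {p. \<exists>q. l = closed_segment p q}"

lemma endpoints_closed_segment [simp]: "endpoints (closed_segment p q) = {p, q}"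
proof -
  have "x \<in> endpoints (closed_segment p q) \<longleftrightarrow> x = p \<or> x = q" for x
    unfolding endpoints_def mem_Collect_eq closed_segment_eq doubleton_eq_iff by blast
  then show ?thesis by blast
qed


section \<open>T-meshes\<close>

record mesh =
  cells :: "point set set"
  edges :: "point set set"

definition vertices :: "mesh \<Rightarrow> point set" where
  "vertices T = (\<Union>l\<in>edges T. endpoints l)"

definition domain_of :: "mesh \<Rightarrow> point set" where
  "domain_of T = \<Union>(cells T)"

definition T_mesh :: "mesh \<Rightarrow> bool" where
  "T_mesh T \<longleftrightarrow>
     finite (cells T) \<and> (\<forall>f\<in>cells T. rectangle f) \<and>
     finite (edges T) \<and> (\<forall>l\<in>edges T. horizontal l \<or> vertical l) \<and>
     (\<forall>l\<in>edges T. l \<subseteq> (\<Union>f\<in>cells T. frontier f)) \<and>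
     (\<forall>f\<in>cells T. \<exists>E. E \<subseteq> edges T \<and> frontier f = \<Union>E) \<and>
     (\<forall>f\<in>cells T. \<forall>f'\<in>cells T. f \<noteq> f' \<longrightarrow>
        f \<inter> f' = frontier f \<inter> frontier f' \<and>
        (\<exists>V E. V \<subseteq> vertices T \<and> E \<subseteq> edges T \<and> f \<inter> f' = V \<union> \<Union>E)) \<and>
     (\<forall>l\<in>edges T. \<forall>l'\<in>edges T. l \<noteq> l' \<longrightarrow>
        l \<inter> l' = endpoints l \<inter> endpoints l' \<and> l \<inter> l' \<subseteq> vertices T) \<and>
     (\<forall>v\<in>vertices T. \<exists>h\<in>edges T. \<exists>w\<in>edges T. horizontal h \<and> vertical w \<and> h \<inter> w = {v}) \<and>
     simply_connected (domain_of T) \<and> connected (interior (domain_of T))"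

definition interior_vertices :: "mesh \<Rightarrow> point set" where
  "interior_vertices T = vertices T \<inter> interior (domain_of T)"

definition interior_edges :: "mesh \<Rightarrow> point set set" where
  "interior_edges T = {l \<in> edges T. \<not> l \<subseteq> frontier (domain_of T)}"


section \<open>l-edges\<close>

definition mesh_segment :: "mesh \<Rightarrow> point set \<Rightarrow> bool" where
  "mesh_segment T s \<longleftrightarrow>
     (\<exists>E. E \<noteq> {} \<and> E \<subseteq> edges T \<and> s = \<Union>E \<and> connected s \<and> collinear s)"

definition l_edges :: "mesh \<Rightarrow> point set set" where
  "l_edges T = {l. mesh_segment T l \<and> (\<forall>s. mesh_segment T s \<and> l \<subseteq> s \<longrightarrow> s = l)}"

definition interior_l_edges :: "mesh \<Rightarrow> point set set" where
  "interior_l_edges T = {l \<in> l_edges T. \<exists>E. E \<subseteq> interior_edges T \<and> l = \<Union>E}"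

definition T_l_edges :: "mesh \<Rightarrow> point set set" where
  "T_l_edges T = {l \<in> interior_l_edges T. endpoints l \<subseteq> interior_vertices T}"

definition T_component_connected :: "mesh \<Rightarrow> bool" where
  "T_component_connected T \<longleftrightarrow> connected (\<Union>(T_l_edges T))"

definition vanishable :: "nat \<Rightarrow> mesh \<Rightarrow> point set \<Rightarrow> bool" where
  "vanishable d T l \<longleftrightarrow> card (vertices T \<inter> l) < d + 2"


section \<open>t-partitions\<close>

text \<open>A t-partition is represented by the list \<open>[l\<^sub>1, \<dots>, l\<^sub>t]\<close> of all T l-edges from which it is
  formed; list positions are counted from 0.\<close>

definition t_partition :: "mesh \<Rightarrow> point set list \<Rightarrow> bool" where
  "t_partition T ls \<longleftrightarrow> distinct ls \<and> set ls = T_l_edges T"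

definition retained :: "mesh \<Rightarrow> point set list \<Rightarrow> nat \<Rightarrow> point set" where
  "retained T ls i = (vertices T \<inter> ls ! i) - (\<Union>j<i. ls ! j)"

definition diagonalizable :: "nat \<Rightarrow> mesh \<Rightarrow> bool" where
  "diagonalizable d T \<longleftrightarrow>
     (\<exists>ls. t_partition T ls \<and> (\<forall>i<length ls. card (retained T ls i) \<ge> d + 1))"


section \<open>Conformality matrices\<close>

definition coord :: "point set \<Rightarrow> point \<Rightarrow> real" where
  "coord l v = (if horizontal l then fst v else snd v)"

text \<open>An arbitrary enumeration of a finite set. It only serves to index the rows and columns of the
  matrices below by natural numbers; their ranks do not depend on it.\<close>

definition enum_of :: "'a set \<Rightarrow> 'a list" where
  "enum_of A = (SOME xs. distinct xs \<and> set xs = A)"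

lemma enum_of: "finite A \<Longrightarrow> distinct (enum_of A) \<and> set (enum_of A) = A"
  unfolding enum_of_def by (rule someI_ex) (metis finite_distinct_list)

text \<open>The coefficient matrix of the equations \<open>\<Sum>v\<in>V \<inter> l. coord l v ^ k * \<delta> v = 0\<close> for
  \<open>l \<in> L\<close> and \<open>k = 0, \<dots>, d\<close>, in the unknowns \<open>\<delta> v\<close> with \<open>v \<in> V\<close>. Row \<open>a * (d + 1) + k\<close> is the
  \<open>k\<close>-th equation of the \<open>a\<close>-th element of \<open>L\<close>.\<close>

definition conformality_matrix :: "nat \<Rightarrow> point set set \<Rightarrow> point set \<Rightarrow> real Matrix.mat" where
  "conformality_matrix d L V =
     Matrix.mat (card L * (d + 1)) (card V)
       (\<lambda>(r, c). let l = enum_of L ! (r div (d + 1)); v = enum_of V ! c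
                 in if v \<in> l then coord l v ^ (r mod (d + 1)) else 0)"

definition M_component :: "nat \<Rightarrow> mesh \<Rightarrow> real Matrix.mat" where
  "M_component d T = conformality_matrix d (T_l_edges T) (vertices T \<inter> \<Union>(T_l_edges T))"

definition M_local :: "nat \<Rightarrow> mesh \<Rightarrow> point set list \<Rightarrow> nat \<Rightarrow> real Matrix.mat" where
  "M_local d T ls i = conformality_matrix d {ls ! i} (retained T ls i)"

definition rank_of :: "real Matrix.mat \<Rightarrow> nat" where
  "rank_of A = vec_space.rank (dim_row A) A"

definition full_row_rank :: "real Matrix.mat \<Rightarrow> bool" where
  "full_row_rank A \<longleftrightarrow> rank_of A = dim_row A"

lemma dim_M_local:
  "dim_row (M_local d T ls i) = d + 1"
  "dim_col (M_local d T ls i) = card (retained T ls i)"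
  by (simp_all add: M_local_def conformality_matrix_def)

end

theory Submission
  imports Defs
begin

text \<open>
  A row of a conformality matrix lists the values of a monomial of degree at most \<open>d\<close> at the vertices
  of an l-edge, with zeros at all other vertices. So a linear relation between the rows is a choice of
  one polynomial of degree at most \<open>d\<close> for each l-edge such that at every vertex the values of the
  polynomials of the l-edges through it add up to zero. The rows are independent precisely when such
  a choice must consist of zero polynomials.

  For a single edge \<open>l\<^sub>i\<close> with its retained vertices this is a Vandermonde argument. The coordinate
  along the edge separates the vertices, so with at least \<open>d + 1\<close> of them the polynomial has too many
  roots and vanishes; with fewer, the matrix has fewer columns than its \<open>d + 1\<close> rows. Hence the local
  matrix has full row rank exactly if \<open>n(l\<^sub>i) \<ge> d + 1\<close>, and diagonalizability is full row rank of
  all local matrices.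

  For the whole component the same relation is peeled off from the last edge of the ordering. A
  vertex retained on \<open>l\<^sub>i\<close> lies on no earlier edge, so once the polynomials of all later edges are
  known to be zero, the relation at that vertex only says that the polynomial of \<open>l\<^sub>i\<close> vanishes there,
  and \<open>d + 1\<close> such vertices force it to be zero. In matrix terms the component matrix is block
  triangular with the local matrices on the diagonal. That \<open>d + 1\<close> retained
  vertices suffice, on a single edge as well as on the component, is
  \<open>full_row_rank_conformality_matrix_if_peelable\<close>.

  The geometric input is \<open>inj_on_coord_T_l_edge\<close>: the coordinate assigned to a T l-edge separates
  its points, because the l-edge is a horizontal segment or lies on a vertical line.
\<close>

section \<open>Row rank and left kernel\<close>

text \<open>
  The rank is the dimension of the column space. A trivial left kernel makes the Gram matrix
  \<open>A A\<^sup>T\<close> injective, since \<open>A A\<^sup>T y = 0\<close> gives \<open>\<parallel>A\<^sup>T y\<parallel>\<^sup>2 = 0\<close> over the reals. So \<open>A A\<^sup>T\<close> is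
  invertible and \<open>A\<close> has a right inverse, which makes every vector a combination of its columns.
\<close>

lemma full_row_rank_if_left_kernel_trivial:
  assumes A: "A \<in> carrier_mat n m"
    and kernel: "\<And>y. y \<in> carrier_vec n \<Longrightarrow> transpose_mat A *\<^sub>v y = 0\<^sub>v m \<Longrightarrow> y = 0\<^sub>v n"
  shows "full_row_rank A"
proof -
  interpret vec_space "TYPE(real)" n .
  define G where "G = A * transpose_mat A"
  have At: "transpose_mat A \<in> carrier_mat m n" and G: "G \<in> carrier_mat n n"
    using A by (auto simp: G_def)
  have "y = 0\<^sub>v n" if y: "y \<in> carrier_vec n" and Gy: "G *\<^sub>v y = 0\<^sub>v n" for y
  proof -
    let ?z = "transpose_mat A *\<^sub>v y"
    have z: "?z \<in> carrier_vec m" using At y by simp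
    have "scalar_prod ?z ?z = scalar_prod y (A *\<^sub>v ?z)"
      by (rule transpose_vec_mult_scalar[OF A z y])
    also have "A *\<^sub>v ?z = 0\<^sub>v n"
      using assoc_mult_mat_vec[OF A At y] Gy by (simp add: G_def)
    also have "scalar_prod y (0\<^sub>v n) = 0" using y by simp
    finally have "?z = 0\<^sub>v m"
      using conjugate_square_eq_0_vec[OF z] by simp
    then show ?thesis by (rule kernel[OF y])
  qed
  then have "Determinant.det G \<noteq> 0"
    using det_0_iff_vec_prod_zero_field[OF G] by blast
  then obtain B where B: "B \<in> carrier_mat n n" and GB: "G * B = 1\<^sub>m n"
    using det_non_zero_imp_unit[OF G, of "()"] by (auto simp: Units_def ring_mat_def)
  have "w \<in> col_space A" if w: "w \<in> carrier_vec n" for w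
  proof -
    let ?u = "transpose_mat A *\<^sub>v (B *\<^sub>v w)"
    have Bw: "B *\<^sub>v w \<in> carrier_vec n" using B w by simp
    have "A *\<^sub>v ?u = G *\<^sub>v (B *\<^sub>v w)"
      using assoc_mult_mat_vec[OF A At Bw] by (simp add: G_def)
    also have "\<dots> = w"
      using assoc_mult_mat_vec[OF G B w] w by (simp add: GB)
    finally show ?thesis
      using A At Bw w by (auto simp: col_space_eq[OF A] intro!: bexI[of _ ?u])
  qed
  then have "span (set (cols A)) = carrier_vec n"
    using col_space_eq[OF A] A by (auto simp: col_space_def)
  then have "rank A = n"
    using dim_is_n by (simp add: rank_def module_vec_def)
  then show ?thesis using A by (simp add: full_row_rank_def rank_of_def)
qed

lemma full_row_rank_dim_le:
  assumes "full_row_rank A"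
  shows "dim_row A \<le> dim_col A"
proof -
  interpret vec_space "TYPE(real)" "dim_row A" .
  have "rank A \<le> dim_col A" by (rule rank_le_nc) simp
  then show ?thesis using assms by (simp add: full_row_rank_def rank_of_def)
qed

section \<open>Rank of conformality matrices\<close>

lemma coeffs_eq_0_if_many_roots:
  fixes c :: "nat \<Rightarrow> real"
  assumes "finite S" "card S \<ge> d + 1"
    and "\<And>x. x \<in> S \<Longrightarrow> (\<Sum>k\<le>d. c k * x ^ k) = 0" and "k \<le> d"
  shows "c k = 0"
proof (rule ccontr)
  assume "c k \<noteq> 0"
  then have "finite {x. (\<Sum>k\<le>d. c k * x ^ k) = 0}" "card {x. (\<Sum>k\<le>d. c k * x ^ k) = 0} \<le> d"
    using Transcendental.polyfun_rootbound[of c k d] \<open>k \<le> d\<close> by auto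
  moreover have "S \<subseteq> {x. (\<Sum>k\<le>d. c k * x ^ k) = 0}" using assms(3) by blast
  ultimately have "card S \<le> d" by (meson card_mono le_trans)
  then show False using assms(2) by simp
qed

text \<open>
  Translates the left kernel of the matrix into families of polynomials \<open>\<Sum>k\<le>d. p l k * t ^ k\<close>, one
  for each \<open>l \<in> L\<close>, and thereby eliminates the enumerations of \<open>L\<close> and \<open>V\<close> that index the matrix.
\<close>

lemma full_row_rank_conformality_matrix_if_left_kernel_trivial:
  assumes L: "finite L" and V: "finite V"
    and kernel: "\<And>p l k. (\<And>v. v \<in> V \<Longrightarrow>
                    (\<Sum>l\<in>{l\<in>L. v \<in> l}. \<Sum>k\<le>d. p l k * coord l v ^ k) = 0) \<Longrightarrow>
                  l \<in> L \<Longrightarrow> k \<le> d \<Longrightarrow> p l k = 0"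
  shows "full_row_rank (conformality_matrix d L V)"
proof -
  let ?N = "card L * (d + 1)"
  let ?M = "conformality_matrix d L V"
  define ls where "ls = enum_of L"
  define vs where "vs = enum_of V"
  have ls: "distinct ls" "set ls = L" "length ls = card L"
    and vs: "distinct vs" "set vs = V" "length vs = card V"
    using enum_of[OF L] enum_of[OF V] distinct_card[of "enum_of L"] distinct_card[of "enum_of V"]
    by (auto simp: ls_def vs_def)
  have M: "?M \<in> carrier_mat ?N (card V)" by (simp add: conformality_matrix_def)
  have "y = 0\<^sub>v ?N" if y: "y \<in> carrier_vec ?N"
    and ker: "transpose_mat ?M *\<^sub>v y = 0\<^sub>v (card V)" for y
  proof -
    define pos where "pos = inv_into {..<card L} (\<lambda>a. ls ! a)"
    have bij: "bij_betw (\<lambda>a. ls ! a) {..<card L} L"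
      using bij_betw_nth[OF ls(1)] ls by auto
    have pos: "pos (ls ! a) = a" if "a < card L" for a
      using that bij_betw_inv_into_left[OF bij] by (simp add: pos_def)
    define p where "p l k = vec_index y (pos l * (d + 1) + k)" for l k
    have vanish: "(\<Sum>l\<in>{l\<in>L. v \<in> l}. \<Sum>k\<le>d. p l k * coord l v ^ k) = 0" if v: "v \<in> V" for v
    proof -
      obtain c where c: "c < card V" "vs ! c = v" using v vs by (metis in_set_conv_nth)
      let ?g = "\<lambda>l k. if v \<in> l then coord l v ^ k else 0"
      have entry: "?M $$ (r, c) = ?g (ls ! (r div (d + 1))) (r mod (d + 1))" if "r < ?N" for r
        using that c by (simp add: conformality_matrix_def ls_def vs_def Let_def)
      \<comment> \<open>The relation at \<open>v\<close> is the \<open>c\<close>-th entry of the product. The row index splits as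
        \<open>r = a * (d + 1) + k\<close>, which turns the sum over rows into a sum over edges and powers.\<close>
      have "0 = vec_index (transpose_mat ?M *\<^sub>v y) c" using ker c by simp
      also have "\<dots> = (\<Sum>r<?N. ?M $$ (r, c) * vec_index y r)"
        using M y c by (simp add: scalar_prod_def lessThan_atLeast0)
      also have "\<dots> = (\<Sum>r<?N. ?g (ls ! (r div (d + 1))) (r mod (d + 1)) * vec_index y r)"
        by (intro sum.cong refl) (simp only: entry lessThan_iff)
      also have "\<dots> = (\<Sum>a<card L. \<Sum>r = a * (d + 1)..<a * (d + 1) + (d + 1).
                        ?g (ls ! (r div (d + 1))) (r mod (d + 1)) * vec_index y r)"
        by (rule sum.nat_group[symmetric])
      also have "\<dots> = (\<Sum>a<card L. \<Sum>k<d + 1. ?g (ls ! a) k * p (ls ! a) k)"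
      proof (rule sum.cong[OF refl])
        fix a assume a: "a \<in> {..<card L}"
        have "(\<Sum>r = a * (d + 1)..<a * (d + 1) + (d + 1).
                  ?g (ls ! (r div (d + 1))) (r mod (d + 1)) * vec_index y r) =
              (\<Sum>k<d + 1. ?g (ls ! ((a * (d + 1) + k) div (d + 1))) ((a * (d + 1) + k) mod (d + 1))
                  * vec_index y (a * (d + 1) + k))"
          using sum.shift_bounds_nat_ivl[of
              "\<lambda>r. ?g (ls ! (r div (d + 1))) (r mod (d + 1)) * vec_index y r" 0 "a * (d + 1)" "d + 1"]
          by (simp only: lessThan_atLeast0 add_0 add.commute)
        also have "\<dots> = (\<Sum>k<d + 1. ?g (ls ! a) k * p (ls ! a) k)"
        proof (rule sum.cong[OF refl])
          fix k assume "k \<in> {..<d + 1}"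
          then have "(a * (d + 1) + k) div (d + 1) = a" "(a * (d + 1) + k) mod (d + 1) = k"
            by (auto intro: div_nat_eqI simp del: mult_Suc_right)
          then show "?g (ls ! ((a * (d + 1) + k) div (d + 1))) ((a * (d + 1) + k) mod (d + 1))
                  * vec_index y (a * (d + 1) + k) = ?g (ls ! a) k * p (ls ! a) k"
            using a by (simp only: p_def pos lessThan_iff)
        qed
        finally show "(\<Sum>r = a * (d + 1)..<a * (d + 1) + (d + 1).
                  ?g (ls ! (r div (d + 1))) (r mod (d + 1)) * vec_index y r) =
              (\<Sum>k<d + 1. ?g (ls ! a) k * p (ls ! a) k)" .
      qed
      also have "\<dots> = (\<Sum>l\<in>L. \<Sum>k<d + 1. ?g l k * p l k)"
        by (rule sum.reindex_bij_betw[OF bij])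
      also have "\<dots> = (\<Sum>l\<in>L. if v \<in> l then \<Sum>k\<le>d. p l k * coord l v ^ k else 0)"
        by (intro sum.cong refl) (simp add: lessThan_Suc_atMost mult.commute)
      also have "\<dots> = (\<Sum>l\<in>{l\<in>L. v \<in> l}. \<Sum>k\<le>d. p l k * coord l v ^ k)"
        using L by (simp add: sum.inter_filter)
      finally show ?thesis by simp
    qed
    show ?thesis
    proof (rule eq_vecI)
      fix r assume "r < dim_vec (0\<^sub>v ?N)"
      then have r: "r < ?N" by simp
      then have a: "r div (d + 1) < card L" by (simp add: less_mult_imp_div_less)
      have "r mod (d + 1) \<le> d" using mod_less_divisor[of "d + 1" r] by linarith
      moreover have "ls ! (r div (d + 1)) \<in> L" using a ls by auto
      ultimately have "p (ls ! (r div (d + 1))) (r mod (d + 1)) = 0"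
        using kernel[of p] vanish by blast
      moreover have "p (ls ! (r div (d + 1))) (r mod (d + 1)) = vec_index y r"
        unfolding p_def pos[OF a] by (simp only: div_mult_mod_eq)
      ultimately show "vec_index y r = vec_index (0\<^sub>v ?N) r" using r by simp
    qed (use y in simp)
  qed
  then show ?thesis by (rule full_row_rank_if_left_kernel_trivial[OF M])
qed

text \<open>
  Block triangularity: the polynomials of a relation vanish one after the other, from the last edge
  of \<open>ls\<close> to the first. At a vertex of \<open>V\<close> on \<open>ls ! i\<close> but on no earlier edge, the only other edges
  that contribute are later ones, whose polynomials are already known to be zero.
\<close>

lemma full_row_rank_conformality_matrix_if_peelable:
  assumes ls: "distinct ls" "set ls = L" and V: "finite V"
    and inj: "\<And>l. l \<in> L \<Longrightarrow> inj_on (coord l) l"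
    and many: "\<And>i. i < length ls \<Longrightarrow> card (V \<inter> ls ! i - (\<Union>j<i. ls ! j)) \<ge> d + 1"
  shows "full_row_rank (conformality_matrix d L V)"
proof (rule full_row_rank_conformality_matrix_if_left_kernel_trivial)
  show "finite L" using ls by auto
  fix p :: "point set \<Rightarrow> nat \<Rightarrow> real" and l k
  assume vanish: "\<And>v. v \<in> V \<Longrightarrow> (\<Sum>l\<in>{l\<in>L. v \<in> l}. \<Sum>k\<le>d. p l k * coord l v ^ k) = 0"
    and l: "l \<in> L" and k: "k \<le> d"
  have "\<forall>k\<le>d. p (ls ! i) k = 0" if "i < length ls" for i
    using that
  proof (induction "length ls - i" arbitrary: i rule: less_induct)
    case less
    let ?l = "ls ! i"
    let ?R = "V \<inter> ?l - (\<Union>j<i. ls ! j)"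
    have later: "p (ls ! j) k = 0" if "i < j" "j < length ls" "k \<le> d" for j k
      using less.hyps[of j] that by auto
    have lL: "?l \<in> L" using less.prems ls by auto
    have root: "(\<Sum>k\<le>d. p ?l k * coord ?l v ^ k) = 0" if v: "v \<in> ?R" for v
    proof -
      have "(\<Sum>k\<le>d. p l k * coord l v ^ k) = 0" if l: "l \<in> {l\<in>L. v \<in> l} - {?l}" for l
      proof -
        obtain j where j: "j < length ls" "l = ls ! j"
          using l ls by (metis DiffE in_set_conv_nth mem_Collect_eq)
        have "\<not> j < i" using l v j by auto
        moreover have "j \<noteq> i" using l j by auto
        ultimately show ?thesis using later[of j] j by simp
      qed
      then have "(\<Sum>l\<in>{l\<in>L. v \<in> l}. \<Sum>k\<le>d. p l k * coord l v ^ k)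
                 = (\<Sum>k\<le>d. p ?l k * coord ?l v ^ k)"
        using v lL ls by (subst sum.remove[of _ ?l]) (auto intro!: sum.neutral)
      then show ?thesis using vanish v by auto
    qed
    have "inj_on (coord ?l) ?R" using inj[OF lL] by (rule inj_on_subset) auto
    then have "card (coord ?l ` ?R) \<ge> d + 1" using many[OF less.prems] by (simp add: card_image)
    moreover have "finite (coord ?l ` ?R)" using V by simp
    moreover have "(\<Sum>k\<le>d. p ?l k * x ^ k) = 0" if "x \<in> coord ?l ` ?R" for x
      using that root by blast
    ultimately show ?case
      using coeffs_eq_0_if_many_roots[of "coord ?l ` ?R" d "p ?l"] by blast
  qed
  then show "p l k = 0" using l k ls by (metis in_set_conv_nth)
qed (rule V)

section \<open>Coordinates along T l-edges\<close>

lemma horizontal_snd_eq: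
  assumes "horizontal l" "x \<in> l" "y \<in> l"
  shows "snd x = snd y"
  using assms unfolding horizontal_def by (auto simp: closed_segment_same_snd)

lemma horizontalI_of_compact_connected:
  assumes l: "compact l" "connected l" and const: "\<And>x. x \<in> l \<Longrightarrow> snd x = s"
    and pq: "p \<in> l" "q \<in> l" "p \<noteq> q"
  shows "horizontal l"
proof -
  have "connected (fst ` l)" "compact (fst ` l)"
    using l continuous_on_fst[OF continuous_on_id, of l]
    by (auto intro: connected_continuous_image compact_continuous_image)
  then obtain a b where ab: "fst ` l = {a..b}"
    using connected_compact_interval_1[of "fst ` l"] by metis
  have fst: "fst p \<in> {a..b}" "fst q \<in> {a..b}" using pq ab by blast+
  have "fst p \<noteq> fst q" using pq const by (metis prod_eqI)
  then have "a < b" using fst by auto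
  have "l = (\<lambda>t. (t, s)) ` {a..b}"
    using const unfolding ab[symmetric] image_image by (force simp: image_iff)
  also have "\<dots> = closed_segment (a, s) (b, s)"
    using \<open>a < b\<close> by (auto simp: closed_segment_same_snd closed_segment_eq_real_ivl)
  finally show ?thesis
    unfolding horizontal_def using \<open>a < b\<close> by (intro exI[of _ "(a, s)"] exI[of _ "(b, s)"]) simp
qed

text \<open>
  An l-edge is collinear and contains a horizontal or vertical mesh edge, whose direction is then the
  direction of the whole l-edge. As \<open>coord\<close> takes the first component only for a set that is itself a
  segment, a union of horizontal mesh edges must be recognized as one: it is compact and connected.
  Conversely, a vertical l-edge is not horizontal, because it contains two points of different height.
\<close>

lemma inj_on_coord_T_l_edge:
  assumes T: "T_mesh T" and l: "l \<in> T_l_edges T"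
  shows "inj_on (coord l) l"
proof -
  obtain E where E: "E \<noteq> {}" "E \<subseteq> edges T" "l = \<Union>E" "connected l" "collinear l"
  proof -
    have "mesh_segment T l"
      using l by (simp add: T_l_edges_def interior_l_edges_def l_edges_def)
    then show ?thesis using that unfolding mesh_segment_def by metis
  qed
  have hv: "\<forall>e\<in>edges T. horizontal e \<or> vertical e" and fin: "finite (edges T)"
    using T by (auto simp: T_mesh_def)
  obtain e where e: "e \<in> E" using E by blast
  obtain p q where pq: "p \<noteq> q" "snd p = snd q \<or> fst p = fst q" "e = closed_segment p q"
    using hv e E unfolding horizontal_def vertical_def by blast
  have pl: "p \<in> l" "q \<in> l" using pq e E by auto
  obtain u where u: "\<And>x y. x \<in> l \<Longrightarrow> y \<in> l \<Longrightarrow> \<exists>c. x - y = c *\<^sub>R u"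
    using E(5) unfolding collinear_def by blast
  obtain c where c: "p - q = c *\<^sub>R u" using u pl by blast
  have c0: "c \<noteq> 0" using c pq(1) by auto
  have dir: "fst p - fst q = c * fst u" "snd p - snd q = c * snd u"
    using c by (metis fst_diff fst_scaleR real_scaleR_def, metis snd_diff snd_scaleR real_scaleR_def)
  show ?thesis
  proof (cases "snd p = snd q")
    case True
    then have "snd u = 0" using dir c0 by simp
    then have const: "snd x = snd p" if "x \<in> l" for x
      using u[OF that pl(1)]
      by (metis diff_eq_diff_eq diff_self mult_zero_right real_scaleR_def snd_diff snd_scaleR)
    have "compact e" if "e \<in> E" for e
      using hv E(2) that unfolding horizontal_def vertical_def by (metis compact_segment(1) subsetD)
    then have "compact l"
      unfolding E(3) using finite_subset[OF E(2) fin] by (intro compact_Union) auto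
    then have "horizontal l"
      using horizontalI_of_compact_connected[OF _ E(4) const pl pq(1)] by blast
    then show ?thesis
      using const by (auto simp: inj_on_def coord_def prod_eq_iff)
  next
    case False
    then have nh: "\<not> horizontal l" using horizontal_snd_eq pl by blast
    have "fst u = 0" using False pq(2) dir c0 by simp
    then have const: "fst x = fst p" if "x \<in> l" for x
      using u[OF that pl(1)]
      by (metis diff_eq_diff_eq diff_self mult_zero_right real_scaleR_def fst_diff fst_scaleR)
    show ?thesis
      using const nh by (auto simp: inj_on_def coord_def prod_eq_iff)
  qed
qed

lemma finite_vertices:
  assumes "T_mesh T"
  shows "finite (vertices T)"
proof -
  have "finite (endpoints l)" if "l \<in> edges T" for l
  proof -
    have "horizontal l \<or> vertical l" using assms that by (simp add: T_mesh_def)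
    then show ?thesis unfolding horizontal_def vertical_def by auto
  qed
  then show ?thesis using assms by (auto simp: vertices_def T_mesh_def)
qed

section \<open>Diagonalizability and ranks\<close>

theorem proposition4p1:
  fixes d :: nat and T :: mesh
  assumes "d \<ge> 1"
    and "T_mesh T"
    and "T_component_connected T"
    and "\<forall>l\<in>T_l_edges T. \<not> vanishable d T l"
  shows "(diagonalizable d T \<longleftrightarrow>
            (\<exists>ls. t_partition T ls \<and> (\<forall>i<card (T_l_edges T). full_row_rank (M_local d T ls i)))) \<and>
         (\<forall>ls. t_partition T ls \<and> (\<forall>i<card (T_l_edges T). full_row_rank (M_local d T ls i)) \<longrightarrow>
            rank_of (M_component d T) = (\<Sum>i<card (T_l_edges T). rank_of (M_local d T ls i)) \<and>
            (\<Sum>i<card (T_l_edges T). rank_of (M_local d T ls i)) = card (T_l_edges T) * (d + 1))"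
proof -
  let ?L = "T_l_edges T"
  have inj: "inj_on (coord l) l" if "l \<in> ?L" for l
    by (rule inj_on_coord_T_l_edge[OF \<open>T_mesh T\<close> that])
  have fin: "finite (vertices T)" by (rule finite_vertices[OF \<open>T_mesh T\<close>])
  have len: "length ls = card ?L" if "t_partition T ls" for ls
    using that distinct_card unfolding t_partition_def by metis
  have local_iff: "full_row_rank (M_local d T ls i) \<longleftrightarrow> card (retained T ls i) \<ge> d + 1"
    if part: "t_partition T ls" and i: "i < card ?L" for ls i
  proof
    assume "full_row_rank (M_local d T ls i)"
    then show "card (retained T ls i) \<ge> d + 1"
      using full_row_rank_dim_le by (metis dim_M_local)
  next
    assume "card (retained T ls i) \<ge> d + 1"
    \<comment> \<open>The local matrix is the case of the one-element ordering \<open>[ls ! i]\<close> with only the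
      retained vertices as unknowns, all of which lie on \<open>ls ! i\<close>.\<close>
    moreover have "retained T ls i \<inter> [ls ! i] ! 0 - (\<Union>j<0. [ls ! i] ! j) = retained T ls i"
      by (auto simp: retained_def)
    moreover have "inj_on (coord (ls ! i)) (ls ! i)"
      using inj part i len[OF part] nth_mem[of i ls] by (simp add: t_partition_def)
    moreover have "finite (retained T ls i)" using fin by (simp add: retained_def)
    ultimately show "full_row_rank (M_local d T ls i)"
      unfolding M_local_def
      by (intro full_row_rank_conformality_matrix_if_peelable[of "[ls ! i]"]) simp_all
  qed
  have "rank_of (M_component d T) = card ?L * (d + 1)"
    if part: "t_partition T ls" and full: "\<forall>i<card ?L. full_row_rank (M_local d T ls i)" for ls
  proof -
    have "(vertices T \<inter> \<Union>?L) \<inter> ls ! i - (\<Union>j<i. ls ! j) = retained T ls i"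
      if "i < length ls" for i
      using that part nth_mem[of i ls] by (auto simp: retained_def t_partition_def)
    then have "full_row_rank (M_component d T)"
      unfolding M_component_def
      using part fin inj full local_iff[OF part] len[OF part]
      by (intro full_row_rank_conformality_matrix_if_peelable[of ls]) (auto simp: t_partition_def)
    then show ?thesis
      by (simp add: full_row_rank_def M_component_def conformality_matrix_def)
  qed
  moreover have "(\<Sum>i<card ?L. rank_of (M_local d T ls i)) = card ?L * (d + 1)"
    if "\<forall>i<card ?L. full_row_rank (M_local d T ls i)" for ls
    using that by (simp add: full_row_rank_def dim_M_local)
  ultimately show ?thesis
    unfolding diagonalizable_def using local_iff len by metis
qed

end
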